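(* Let $0<\alpha\le 1$ and let $\{\mathcal{N}^{\alpha}_{c}(t)\}_{t\ge 0}$ be the convoluted fractional Poisson process with intensity parameters $\{\lambda_j\}_{j\in\mathbb{Z}}$ (so $\lambda_{-1}=0$). For every integer $r\ge 1$ and $t\ge 0$, the $r$th factorial moment $\psi^{\alpha}_{c}(r,t)=\mathbb{E}\big(\mathcal{N}^{\alpha}_{c}(t)(\mathcal{N}^{\alpha}_{c}(t)-1)\cdots(\mathcal{N}^{\alpha}_{c}(t)-r+1)\big)$ is given by $$\psi^{\alpha}_{c}(r,t)=r!\sum_{k=1}^{r}\frac{t^{k\alpha}}{\Gamma(k\alpha+1)}\sum_{\substack{m_1+\cdots+m_k=r\\ m_j\in\mathbb{N}_0}}\ \prod_{\ell=1}^{k}\left(\frac{1}{m_\ell!}\sum_{j=0}^{\infty}(j)_{m_\ell}(\lambda_{j-1}-\lambda_{j})\right),$$ where $(j)_{m}=j(j-1)\cdots(j-m+1)$ denotes the falling factorial (with $(j)_0=1$).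
   Context: $\mathbb{N}_0$ denotes the non-negative integers. Intensity parameters: $\{\lambda_j\}_{j\in\mathbb{Z}}$ are real numbers with $\lambda_j=0$ for $j<0$, $\lambda_0>0$, $\lambda_j\ge 0$ for $j>0$, non-increasing for $j\ge 0$, and $\lim_{j\to\infty}\lambda_{j+1}/\lambda_j<1$ (this limit condition is regarded as satisfied if $\lambda_j=0$ for all large $j$). Fractional derivative (Dzhrbashyan–Caputo): $\partial_t^{\alpha}f(t)=\frac{1}{\Gamma(1-\alpha)}\int_0^t (t-s)^{-\alpha}f'(s)\,\mathrm{d}s$ for $0<\alpha<1$, and $\partial_t^{1}f(t)=f'(t)$. Convoluted fractional Poisson process (CFPP): an $\mathbb{N}_0$-valued stochastic process $\{\mathcal{N}^{\alpha}_{c}(t)\}_{t\ge0}$ whose state probabilities $p^{\alpha}_{c}(n,t)=\Pr\{\mathcal{N}^{\alpha}_{c}(t)=n\}$ satisfy, for all $n\ge 0$, $$\partial_t^{\alpha}p^{\alpha}_{c}(n,t)=-\lambda_n * p^{\alpha}_{c}(n,t)+\lambda_{n-1}*p^{\alpha}_{c}(n-1,t),$$ where $\lambda_n*p^{\alpha}_{c}(n,t)=\sum_{j=-\infty}^{\infty}\lambda_j p^{\alpha}_{c}(n-j,t)$ is the discrete convolution in the space variable, with $p^{\alpha}_{c}(0,0)=1$, $p^{\alpha}_{c}(n,0)=0$ for $n\ge 1$, and $p^{\alpha}_{c}(-n,t)=0$ for $n\ge 1$, $t\ge 0$. Equivalently, $\partial_t^{\alpha}p^{\alpha}_{c}(n,t)=-\lambda_0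 p^{\alpha}_{c}(n,t)+\sum_{j=1}^{n}(\lambda_{j-1}-\lambda_j)p^{\alpha}_{c}(n-j,t)$. *)

theory Defs
  imports "HOL-Probability.Probability"
begin

definition falling_factorial :: "real \<Rightarrow> nat \<Rightarrow> real" where
  "falling_factorial x m = (\<Prod>i<m. x - real i)"

definition factorial_moment :: "'a measure \<Rightarrow> ('a \<Rightarrow> nat) \<Rightarrow> nat \<Rightarrow> real" where
  "factorial_moment M X r = (LINT \<omega>|M. falling_factorial (real (X \<omega>)) r)"

text \<open>
  The Dzhrbashyan--Caputo derivative, as a total function. The integral is a Lebesgue integral.
  Where the derivative or the integral does not exist the value is meaningless, so equations
  involving it are always accompanied by \<open>caputo_differentiable\<close> below.
\<close>

definition caputo_deriv :: "real \<Rightarrow> (real \<Rightarrow> real) \<Rightarrow> real \<Rightarrow> real" where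
  "caputo_deriv \<alpha> f t =
     (if \<alpha> = 1 then deriv f t
      else 1 / Gamma (1 - \<alpha>) * (LINT s:{0..t}|lborel. (t - s) powr (- \<alpha>) * deriv f s))"

text \<open>
  The ordinary derivative is only required at positive times: for \<open>\<alpha> < 1\<close> the solutions of
  fractional relaxation equations behave like \<open>1 - c t\<^sup>\<alpha>\<close> near \<open>0\<close> and are not differentiable
  there. Continuity on the closed interval ties the solution to its initial value.
\<close>

definition caputo_differentiable :: "real \<Rightarrow> (real \<Rightarrow> real) \<Rightarrow> real \<Rightarrow> bool" where
  "caputo_differentiable \<alpha> f t \<longleftrightarrow>
     continuous_on {0..t} f \<and>
     (\<forall>s\<in>{0<..t}. f differentiable (at s)) \<and>
     (\<alpha> < 1 \<longrightarrow> set_integrable lborel {0..t} (\<lambda>s. (t - s) powr (- \<alpha>) * deriv f s))"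

text \<open>
  In \<open>ratio_limit\<close>, the second alternative is the convention for intensities that vanish from
  some index on.
\<close>

locale intensity_parameters =
  fixes lam :: "int \<Rightarrow> real"
  assumes neg_zero: "\<And>j. j < 0 \<Longrightarrow> lam j = 0"
    and zero_pos: "lam 0 > 0"
    and nonneg: "\<And>j. j > 0 \<Longrightarrow> lam j \<ge> 0"
    and nonincreasing: "\<And>i j. 0 \<le> i \<Longrightarrow> i \<le> j \<Longrightarrow> lam j \<le> lam i"
    and ratio_limit:
      "(\<exists>L<1. (\<lambda>j::nat. lam (int j + 1) / lam (int j)) \<longlonglongrightarrow> L) \<or>
       (\<forall>\<^sub>F j::nat in sequentially. lam (int j) = 0)"

definition state_prob :: "'a measure \<Rightarrow> (real \<Rightarrow> 'a \<Rightarrow> nat) \<Rightarrow> int \<Rightarrow> real \<Rightarrow> real" where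
  "state_prob M N n t = measure M {\<omega> \<in> space M. int (N t \<omega>) = n}"

definition discrete_conv :: "(int \<Rightarrow> real) \<Rightarrow> (int \<Rightarrow> real) \<Rightarrow> int \<Rightarrow> real" where
  "discrete_conv a b n = (\<Sum>\<^sub>\<infinity>j\<in>UNIV. a j * b (n - j))"

text \<open>
  The condition that state probabilities vanish at negative states holds by definition of
  \<open>state_prob\<close>, since the process takes values in the natural numbers. The governing equation is
  imposed for \<open>t > 0\<close> only: at \<open>t = 0\<close> and \<open>\<alpha> < 1\<close> the integral in the Caputo derivative is over
  a null set, whereas the right-hand side is \<open>- lam 0 \<noteq> 0\<close> for \<open>n = 0\<close>.
\<close>

locale convoluted_fractional_poisson_process =
  prob_space M + intensity_parameters lam
  for M :: "'a measure" and lam :: "int \<Rightarrow> real" +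
  fixes \<alpha> :: real and N :: "real \<Rightarrow> 'a \<Rightarrow> nat"
  assumes order: "0 < \<alpha>" "\<alpha> \<le> 1"
    and random_var: "\<And>t. t \<ge> 0 \<Longrightarrow> N t \<in> measurable M (count_space UNIV)"
    and differentiable:
      "\<And>n t. n \<ge> 0 \<Longrightarrow> t > 0 \<Longrightarrow> caputo_differentiable \<alpha> (state_prob M N n) t"
    and governing_equation:
      "\<And>n t. n \<ge> 0 \<Longrightarrow> t > 0 \<Longrightarrow>
         caputo_deriv \<alpha> (state_prob M N n) t =
           - discrete_conv lam (\<lambda>i. state_prob M N i t) n
           + discrete_conv lam (\<lambda>i. state_prob M N i t) (n - 1)"
    and initial_zero: "state_prob M N 0 0 = 1"
    and initial_pos: "\<And>n. n \<ge> 1 \<Longrightarrow> state_prob M N n 0 = 0"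

end

theory Submission
  imports Defs "HOL-Computational_Algebra.Formal_Power_Series"
begin

text \<open>
  Put \<open>c\<^sub>j = \<lambda>\<^bsub>j-1\<^esub> - \<lambda>\<^sub>j\<close> and \<open>C(u) = \<Sum>\<^sub>j c\<^sub>j u\<^sup>j\<close>. Inverting the Caputo derivative (Fubini and a Beta
  integral) turns the governing equations into the Volterra system
  \<open>p(n,t) = \<delta>\<^bsub>n0\<^esub> + I\<^sup>\<alpha> (\<Sum>\<^sub>j c\<^sub>j p(n-j,\<cdot>))(t)\<close>. Iterating it \<open>K\<close> times leaves a remainder of size
  at most \<open>D\<^sup>K t\<^bsup>K\<alpha>\<^esup> / \<Gamma>(K\<alpha>+1)\<close>, because probabilities are bounded by \<open>1\<close>, so that
  \<open>p(n,t) = \<Sum>\<^sub>k [u\<^sup>n] C(u)\<^sup>k t\<^bsup>k\<alpha>\<^esup> / \<Gamma>(k\<alpha>+1)\<close>. The intensities decay geometrically, hence \<open>C\<close> converges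
  beyond \<open>u = 1\<close>, the double series may be summed over \<open>n\<close> first, and the binomial moments of \<open>C\<^sup>k\<close>
  are the Taylor coefficients of \<open>C(1+x)\<^sup>k\<close>. Since \<open>C(1) = 0\<close>, only \<open>1 \<le> k \<le> r\<close> contribute to the
  coefficient of \<open>x\<^sup>r\<close>.
\<close>

unbundle no vec_syntax
unbundle fps_syntax

section \<open>Fractional integrals\<close>

text \<open>The substitution \<open>s = u + (t - u) * x\<close> carries the Beta integral from the
  unit interval to \<open>{u<..<t}\<close>. The Bochner form supplies integrability along with the
  value.\<close>

lemma has_bochner_integral_Beta:
  fixes a b u t :: real
  assumes "a > 0" "b > 0" "u < t"
  shows "has_bochner_integral lborel
    (\<lambda>s. indicator {u<..<t} s * ((s - u) powr (a - 1) * (t - s) powr (b - 1)))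
    (Beta a b * (t - u) powr (a + b - 1))"
proof -
  define k :: "real \<Rightarrow> real"
    where "k = (\<lambda>s. indicator {0<..<1} s * (s powr (a - 1) * (1 - s) powr (b - 1)))"
  define f where "f = (\<lambda>s. indicator {u<..<t} s * ((s - u) powr (a - 1) * (t - s) powr (b - 1)))"
  have meas: "k \<in> borel_measurable borel"
    unfolding k_def by measurable
  have "((\<lambda>s. s powr (a - 1) * (1 - s) powr (b - 1)) has_integral Beta a b) {0<..<1}"
    using has_integral_Beta_real[OF assms(1,2)] by (simp add: has_integral_Icc_iff_Ioo)
  then have "(k has_integral Beta a b) UNIV"
    unfolding k_def by (subst (asm) has_integral_restrict_UNIV [symmetric])
      (auto elim!: has_integral_eq [rotated] simp: indicator_def)
  \<comment> \<open>As \<open>k\<close> is nonnegative, its gauge integral passes to the Lebesgue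
    integral.\<close>
  then have nn: "(\<integral>\<^sup>+x. ennreal (k x) \<partial>lborel) = ennreal (Beta a b)"
    by (intro nn_integral_has_integral_lborel meas) (auto simp: k_def)
  have "Beta a b \<ge> 0"
    using assms by (simp add: Beta_def Gamma_real_pos less_imp_le)
  with nn meas have "has_bochner_integral lborel k (Beta a b)"
    by (intro has_bochner_integral_nn_integral) (auto simp: k_def)
  then have "has_bochner_integral lborel (\<lambda>x. (t - u) powr (a + b - 2) * k x)
      ((t - u) powr (a + b - 2) * Beta a b)"
    by (rule has_bochner_integral_mult_right)
  also have "(\<lambda>x. (t - u) powr (a + b - 2) * k x) = (\<lambda>x. f (u + (t - u) * x))"
  proof
    fix x :: real
    have "(t - u) powr (a + b - 2) = (t - u) powr (a - 1) * (t - u) powr (b - 1)"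
      by (simp add: powr_add [symmetric] algebra_simps)
    moreover have "u + (t - u) * x < t \<longleftrightarrow> x < 1"
    proof -
      have "u + (t - u) * x < t \<longleftrightarrow> (t - u) * x < (t - u) * 1"
        by (simp add: algebra_simps)
      then show ?thesis
        using assms(3) by (subst (asm) mult_less_cancel_left_pos) auto
    qed
    moreover have "t - (u + (t - u) * x) = (t - u) * (1 - x)"
      by (simp add: algebra_simps)
    ultimately show "(t - u) powr (a + b - 2) * k x = f (u + (t - u) * x)"
      using assms(3)
      by (auto simp: k_def f_def indicator_def powr_mult zero_less_mult_iff)
  qed
  \<comment> \<open>The division by \<open>t - u\<close> is made explicit to match the Jacobian in
    the affine rule.\<close>
  finally have "has_bochner_integral lborel (\<lambda>x. f (u + (t - u) * x))
      ((t - u) powr (a + b - 1) * Beta a b / (t - u))"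
    using assms(3) by (simp add: powr_diff power2_eq_square divide_simps)
  then show ?thesis
    unfolding f_def [symmetric] using assms(3)
    by (subst lborel_has_bochner_integral_real_affine_iff [where c = "t - u" and t = u])
      (auto simp: field_simps)
qed

text \<open>The Riemann-Liouville integral of order \<alpha>. The open interval avoids
  \<open>s = t\<close>, where \<open>0 powr x\<close> is \<open>0\<close> by convention even for
  \<open>x = 0\<close>.\<close>

definition frac_integral :: "real \<Rightarrow> (real \<Rightarrow> real) \<Rightarrow> real \<Rightarrow> real" where
  "frac_integral \<alpha> g t =
     1 / Gamma \<alpha> * (LINT s|lborel. indicator {0<..<t} s * ((t - s) powr (\<alpha> - 1) * g s))"

text \<open>The kernel is a Beta integrand with first parameter \<open>1\<close>, and a continuous
  \<open>g\<close> is bounded on the compact interval, so a multiple of the kernel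
  dominates.\<close>

lemma integrable_frac_kernel:
  fixes \<alpha> t :: real and g :: "real \<Rightarrow> real"
  assumes "\<alpha> > 0" "t > 0" "continuous_on {0..t} g"
  shows "integrable lborel (\<lambda>s. indicator {0<..<t} s * ((t - s) powr (\<alpha> - 1) * g s))"
proof -
  have "bounded (g ` {0..t})"
    using assms(3) by (intro compact_imp_bounded compact_continuous_image) auto
  then obtain B where B: "\<And>s. 0 \<le> s \<Longrightarrow> s \<le> t \<Longrightarrow> \<bar>g s\<bar> \<le> B"
    unfolding bounded_iff by (metis atLeastAtMost_iff imageI real_norm_def)
  have ker: "integrable lborel (\<lambda>s. indicator {0<..<t} s * ((t - s) powr (\<alpha> - 1)))"
    using has_bochner_integral_Beta[of 1 \<alpha> 0 t] assms
    by (auto dest!: integrable.intros elim!: integrable_cong_AE_imp intro!: AE_I2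
          simp: indicator_def split: if_splits)
  \<comment> \<open>Only the values of \<open>g\<close> on \<open>{0..t}\<close> are controlled; the
    cut-off is Borel on the whole line and leaves the integrand unchanged.\<close>
  have g: "(\<lambda>s. indicator {0..t} s *\<^sub>R g s) \<in> borel_measurable borel"
    using assms(3) by (intro borel_measurable_continuous_on_indicator) auto
  have eq: "(\<lambda>s. indicator {0<..<t} s * ((t - s) powr (\<alpha> - 1) * g s)) =
      (\<lambda>s. indicator {0<..<t} s * (t - s) powr (\<alpha> - 1) * (indicator {0..t} s *\<^sub>R g s))"
    by (auto simp: indicator_def)
  show ?thesis
    unfolding eq
  proof (rule Bochner_Integration.integrable_bound)
    show "integrable lborel (\<lambda>s. B * (indicator {0<..<t} s * ((t - s) powr (\<alpha> - 1))))"
      by (intro integrable_mult_right ker)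
    show "(\<lambda>s. indicator {0<..<t} s * (t - s) powr (\<alpha> - 1) * (indicator {0..t} s *\<^sub>R g s))
        \<in> borel_measurable lborel"
      using g by (intro borel_measurable_times) auto
    show "AE s in lborel. norm (indicator {0<..<t} s * (t - s) powr (\<alpha> - 1) *
        (indicator {0..t} s *\<^sub>R g s)) \<le> norm (B * (indicator {0<..<t} s * ((t - s) powr (\<alpha> - 1))))"
    proof (intro AE_I2)
      fix s
      have "\<bar>g s\<bar> \<le> \<bar>B\<bar>" if "0 < s" "s < t"
        using B[of s] that by simp
      then show "norm (indicator {0<..<t} s * (t - s) powr (\<alpha> - 1) *
        (indicator {0..t} s *\<^sub>R g s)) \<le> norm (B * (indicator {0<..<t} s * ((t - s) powr (\<alpha> - 1))))"
        by (auto simp: indicator_def abs_mult mult.commute intro: mult_right_mono)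
    qed
  qed
qed

text \<open>The fundamental theorem of calculus, from the derivative inside the interval and
  continuity up to its ends. The kernel is \<open>1\<close> inside, so the two integrands differ at
  most at \<open>0\<close> and \<open>t\<close>.\<close>

lemma caputo_inversion_order_1:
  fixes f g :: "real \<Rightarrow> real"
  assumes "t > 0"
    and diff: "\<And>s. 0 < s \<Longrightarrow> s \<le> t \<Longrightarrow> caputo_differentiable 1 f s"
    and eq: "\<And>s. 0 < s \<Longrightarrow> s \<le> t \<Longrightarrow> caputo_deriv 1 f s = g s"
    and cont: "continuous_on {0..t} g"
  shows "f t = f 0 + frac_integral 1 g t"
proof -
  have df: "(f has_vector_derivative g x) (at x)" if "x \<in> {0<..<t}" for x
  proof -
    have "f differentiable (at x)"
      using diff[of x] that by (auto simp: caputo_differentiable_def)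
    moreover have "deriv f x = g x"
      using eq[of x] that by (simp add: caputo_deriv_def)
    ultimately show ?thesis
      by (metis DERIV_deriv_iff_real_differentiable has_real_derivative_iff_has_vector_derivative)
  qed
  have "continuous_on {0..t} f"
    using diff[of t] \<open>t > 0\<close> by (simp add: caputo_differentiable_def)
  then have "(g has_integral (f t - f 0)) {0..t}"
    using df \<open>t > 0\<close> by (intro fundamental_theorem_of_calculus_interior) auto
  then have *: "integral {0..t} g = f t - f 0"
    by (simp add: integral_unique)
  have "set_integrable lborel {0..t} g"
    using cont by (intro borel_integrable_atLeastAtMost') auto
  then have "(LINT s:{0..t}|lborel. g s) = f t - f 0"
    using * by (simp add: set_borel_integral_eq_integral)
  moreover have "(LINT s:{0..t}|lborel. g s) =
      (LINT s|lborel. indicator {0<..<t} s * ((t - s) powr (1 - 1) * g s))"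
    unfolding set_lebesgue_integral_def
  proof (intro Bochner_Integration.integral_cong_AE)
    have g: "(\<lambda>s. indicator {0..t} s *\<^sub>R g s) \<in> borel_measurable borel"
      using cont by (intro borel_measurable_continuous_on_indicator) auto
    then show "(\<lambda>s. indicator {0..t} s *\<^sub>R g s) \<in> borel_measurable lborel"
      by simp
    show "(\<lambda>s. indicator {0<..<t} s * ((t - s) powr (1 - 1) * g s)) \<in> borel_measurable lborel"
      using integrable_frac_kernel[of 1 t g] \<open>t > 0\<close> cont by simp
    show "AE s in lborel. indicator {0..t} s *\<^sub>R g s =
        indicator {0<..<t} s * ((t - s) powr (1 - 1) * g s)"
      using AE_lborel_singleton[of 0] AE_lborel_singleton[of t]
      by eventually_elim (auto simp: indicator_def)
  qed
  ultimately show ?thesis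
    by (simp add: frac_integral_def)
qed


text \<open>Integrating the equation against \<open>(t - s) powr (\<alpha> - 1)\<close> gives a
  double integral of \<open>deriv f u\<close> over \<open>u < s < t\<close>. Integration in
  \<open>s\<close> yields a Beta constant independent of \<open>u\<close>, and the integral of
  \<open>deriv f\<close>, namely \<open>f t - f 0\<close>, is left.\<close>

lemma caputo_inversion_order_less_1:
  fixes f g :: "real \<Rightarrow> real"
  assumes "0 < \<alpha>" "\<alpha> < 1" "t > 0"
    and diff: "\<And>s. 0 < s \<Longrightarrow> s \<le> t \<Longrightarrow> caputo_differentiable \<alpha> f s"
    and eq: "\<And>s. 0 < s \<Longrightarrow> s \<le> t \<Longrightarrow> caputo_deriv \<alpha> f s = g s"
  shows "f t = f 0 + frac_integral \<alpha> g t"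
proof -
  \<comment> \<open>Differentiability is known only at positive times up to \<open>t\<close>, so
    \<open>deriv f\<close> is cut off to the open interval.\<close>
  define H where "H = (\<lambda>s. indicator {0<..<t} s * deriv f s)"
  have int: "set_integrable lborel {0..s} (\<lambda>u. (s - u) powr (- \<alpha>) * deriv f u)"
    if "0 < s" "s \<le> t" for s
    using diff[OF that] \<open>\<alpha> < 1\<close> by (simp add: caputo_differentiable_def)
  have int_H: "integrable lborel H"
  proof -
    define F where "F = (\<lambda>u. indicator {0..t} u *\<^sub>R ((t - u) powr (- \<alpha>) * deriv f u))"
    have F: "integrable lborel F"
      using int[of t] \<open>t > 0\<close> by (simp add: set_integrable_def F_def)
    \<comment> \<open>The bounded factor \<open>(t - s) powr \<alpha>\<close> undoes the singular
      kernel in \<open>F\<close>, so integrability of \<open>F\<close> passes to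
      \<open>H\<close>.\<close>
    have H_eq: "H = (\<lambda>s. (indicator {0<..<t} s * (t - s) powr \<alpha>) * F s)"
      by (auto simp: H_def F_def indicator_def powr_minus)
    have meas: "F \<in> borel_measurable borel"
      using borel_measurable_integrable[OF F] by simp
    show ?thesis
    proof (rule Bochner_Integration.integrable_bound)
      show "integrable lborel (\<lambda>s. t powr \<alpha> * F s)"
        using F by simp
      show "H \<in> borel_measurable lborel"
        unfolding H_eq using meas by measurable
      show "AE s in lborel. norm (H s) \<le> norm (t powr \<alpha> * F s)"
        unfolding H_eq using \<open>0 < \<alpha>\<close>
        by (intro AE_I2) (auto simp: indicator_def abs_mult intro!: mult_right_mono powr_mono2)
    qed
  qed
  then have meas_H [measurable]: "H \<in> borel_measurable borel"
    using borel_measurable_integrable by force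
  have LINT_H: "(LINT s|lborel. H s) = f t - f 0"
  proof -
    have "(f has_vector_derivative deriv f x) (at x)" if "x \<in> {0<..<t}" for x
      using diff[of x] that
      by (auto simp: caputo_differentiable_def DERIV_deriv_iff_real_differentiable
          simp flip: has_real_derivative_iff_has_vector_derivative)
    moreover have "continuous_on {0..t} f"
      using diff[of t] \<open>t > 0\<close> by (simp add: caputo_differentiable_def)
    ultimately have "(deriv f has_integral (f t - f 0)) {0..t}"
      using \<open>t > 0\<close> by (intro fundamental_theorem_of_calculus_interior) auto
    then have "(deriv f has_integral (f t - f 0)) {0<..<t}"
      by (simp add: has_integral_Icc_iff_Ioo)
    moreover have "set_integrable lborel {0<..<t} (deriv f)"
      using int_H by (simp add: set_integrable_def H_def)
    ultimately have "(LINT s:{0<..<t}|lborel. deriv f s) = f t - f 0"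
      by (simp add: set_borel_integral_eq_integral integral_unique)
    then show ?thesis
      by (simp add: set_lebesgue_integral_def H_def)
  qed
  define B where "B = Beta (1 - \<alpha>) \<alpha>"
  define w where
    "w = (\<lambda>u s. if u < s \<and> s < t then (s - u) powr (- \<alpha>) * (t - s) powr (\<alpha> - 1) else 0)"
  have w_nonneg: "w u s \<ge> 0" for u s
    by (simp add: w_def)
  \<comment> \<open>The exponents \<open>- \<alpha>\<close> and \<open>\<alpha> - 1\<close> add up
    to \<open>-1\<close>, so \<open>t - u\<close> enters the Beta value with exponent
    \<open>0\<close>.\<close>
  have w_int: "has_bochner_integral lborel (w u) B" if "u < t" for u
  proof -
    have "w u = (\<lambda>s. indicator {u<..<t} s * ((s - u) powr ((1 - \<alpha>) - 1) * (t - s) powr (\<alpha> - 1)))"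
      by (auto simp: w_def indicator_def)
    then show ?thesis
      using has_bochner_integral_Beta[of "1 - \<alpha>" \<alpha> u t] that assms by (simp add: B_def)
  qed
  have inner_s: "has_bochner_integral lborel (\<lambda>s. w u s * H u) (B * H u)" for u
  proof (cases "u < t")
    case True
    then show ?thesis
      using w_int by (intro has_bochner_integral_mult_left) auto
  next
    case False
    then have "H u = 0"
      by (simp add: H_def)
    then show ?thesis
      by (simp add: has_bochner_integral_zero)
  qed
  have w_meas [measurable]: "(\<lambda>(u, s). w u s) \<in> borel_measurable (borel \<Otimes>\<^sub>M borel)"
    unfolding w_def by measurable
  have fubini: "integrable (lborel \<Otimes>\<^sub>M lborel) (\<lambda>(u, s). w u s * H u)"
  proof (rule lborel_pair.Fubini_integrable)
    show "(\<lambda>(u, s). w u s * H u) \<in> borel_measurable (lborel \<Otimes>\<^sub>M lborel)"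
      by measurable
    show "AE u in lborel. integrable lborel (\<lambda>s. case (u, s) of (u, s) \<Rightarrow> w u s * H u)"
      unfolding prod.case by (intro AE_I2 integrable.intros[OF inner_s])
    have "(LINT s|lborel. norm (w u s * H u)) = B * \<bar>H u\<bar>" for u
    proof (cases "u < t")
      case True
      then have "has_bochner_integral lborel (\<lambda>s. w u s * \<bar>H u\<bar>) (B * \<bar>H u\<bar>)"
        by (intro has_bochner_integral_mult_left w_int)
      moreover have "norm (w u s * H u) = w u s * \<bar>H u\<bar>" for s
        using w_nonneg by (simp add: abs_mult)
      ultimately show ?thesis
        by (simp only: has_bochner_integral_integral_eq)
    next
      case False
      then show ?thesis
        by (simp add: H_def)
    qed
    then show "integrable lborel (\<lambda>u. LINT s|lborel. norm (case (u, s) of (u, s) \<Rightarrow> w u s * H u))"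
      using int_H by simp
  qed
  \<comment> \<open>In the other order, the integral in \<open>u\<close> is the one that defines the
    Caputo derivative at \<open>s\<close>.\<close>
  have inner_u: "(LINT u|lborel. w u s * H u) =
      Gamma (1 - \<alpha>) * (indicator {0<..<t} s * ((t - s) powr (\<alpha> - 1) * g s))" for s
  proof (cases "s \<in> {0<..<t}")
    case True
    have eq_w: "w u s * H u = (t - s) powr (\<alpha> - 1) *
        (indicator {0<..<s} u * ((s - u) powr (- \<alpha>) * deriv f u))" for u
      using True by (auto simp: w_def H_def indicator_def)
    have "(LINT u|lborel. indicator {0<..<s} u * ((s - u) powr (- \<alpha>) * deriv f u)) =
        (LINT u:{0..s}|lborel. (s - u) powr (- \<alpha>) * deriv f u)"
      unfolding set_lebesgue_integral_def
    proof (rule Bochner_Integration.integral_cong_AE)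
      have "(\<lambda>u. indicator {0<..<s} u * ((s - u) powr (- \<alpha>) * deriv f u)) =
          (\<lambda>u. indicator {0<..<s} u * (s - u) powr (- \<alpha>) * H u)"
        using True by (auto simp: H_def indicator_def)
      also have "\<dots> \<in> borel_measurable lborel"
        by measurable
      finally show "(\<lambda>u. indicator {0<..<s} u * ((s - u) powr (- \<alpha>) * deriv f u))
        \<in> borel_measurable lborel" .
      show "(\<lambda>u. indicator {0..s} u *\<^sub>R ((s - u) powr (- \<alpha>) * deriv f u)) \<in> borel_measurable lborel"
        using int[of s] True by (simp add: set_integrable_def)
      show "AE u in lborel. indicator {0<..<s} u * ((s - u) powr (- \<alpha>) * deriv f u) =
          indicator {0..s} u *\<^sub>R ((s - u) powr (- \<alpha>) * deriv f u)"
        using AE_lborel_singleton[of 0] AE_lborel_singleton[of s]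
        by eventually_elim (auto simp: indicator_def)
    qed
    also have "\<dots> = Gamma (1 - \<alpha>) * g s"
    proof -
      have "Gamma (1 - \<alpha>) \<noteq> 0"
        using \<open>\<alpha> < 1\<close> Gamma_real_pos[of "1 - \<alpha>"] by linarith
      then show ?thesis
        using eq[of s] True \<open>\<alpha> < 1\<close> by (auto simp: caputo_deriv_def field_simps)
    qed
    finally show ?thesis
      using True by (simp add: eq_w)
  next
    case False
    then have "(\<lambda>u. w u s * H u) = (\<lambda>u. 0)"
      by (auto simp: w_def H_def indicator_def)
    then show ?thesis
      using False by simp
  qed
  from fubini have "(LINT s|lborel. LINT u|lborel. w u s * H u) = (LINT u|lborel. LINT s|lborel. w u s * H u)"
    by (rule lborel_pair.Fubini_integral)
  also have "\<dots> = (LINT u|lborel. B * H u)"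
    by (simp only: has_bochner_integral_integral_eq[OF inner_s])
  also have "\<dots> = B * (f t - f 0)"
    using LINT_H by simp
  finally have "Gamma (1 - \<alpha>) *
      (LINT s|lborel. indicator {0<..<t} s * ((t - s) powr (\<alpha> - 1) * g s)) = B * (f t - f 0)"
    by (simp only: inner_u integral_mult_right_zero)
  \<comment> \<open>The denominator of this Beta value is \<open>Gamma 1 = 1\<close>.\<close>
  also have "\<dots> = Gamma (1 - \<alpha>) * (Gamma \<alpha> * (f t - f 0))"
    by (simp add: B_def Beta_def)
  finally have "(LINT s|lborel. indicator {0<..<t} s * ((t - s) powr (\<alpha> - 1) * g s)) =
      Gamma \<alpha> * (f t - f 0)"
    by (rule mult_left_cancel[THEN iffD1, rotated])
      (use Gamma_real_pos[of "1 - \<alpha>"] \<open>\<alpha> < 1\<close> in linarith)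
  moreover have "Gamma \<alpha> \<noteq> 0"
    using Gamma_real_pos[of \<alpha>] \<open>0 < \<alpha>\<close> by linarith
  ultimately show ?thesis
    by (simp add: frac_integral_def)
qed

lemma caputo_inversion:
  fixes f g :: "real \<Rightarrow> real"
  assumes "0 < \<alpha>" "\<alpha> \<le> 1" "t > 0"
    and "\<And>s. 0 < s \<Longrightarrow> s \<le> t \<Longrightarrow> caputo_differentiable \<alpha> f s"
    and "\<And>s. 0 < s \<Longrightarrow> s \<le> t \<Longrightarrow> caputo_deriv \<alpha> f s = g s"
    and "continuous_on {0..t} g"
  shows "f t = f 0 + frac_integral \<alpha> g t"
  using assms caputo_inversion_order_1[of t f g] caputo_inversion_order_less_1[of \<alpha> t f g]
  by (cases "\<alpha> = 1") auto

section \<open>Mittag-Leffler series\<close>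

text \<open>Log-convexity of Gamma on the segment from \<open>x - 1\<close> to
  \<open>x + \<alpha>\<close>, where \<open>x\<close> has weight \<open>1 / (1 + \<alpha>)\<close>
  on the right end; the functional equation then eliminates \<open>Gamma (x - 1)\<close>.\<close>

lemma Gamma_quotient_le:
  fixes x \<alpha> :: real
  assumes "\<alpha> > 0" "x > 1"
  shows "Gamma x / Gamma (x + \<alpha>) \<le> (x - 1) powr (- \<alpha>)"
proof -
  define G where "G = (\<lambda>x::real. ln (Gamma x))"
  have "convex_on {0<..} G"
    using log_convex_Gamma_real by (simp add: G_def o_def)
  then have "G ((1 - 1 / (1 + \<alpha>)) *\<^sub>R (x - 1) + (1 / (1 + \<alpha>)) *\<^sub>R (x + \<alpha>)) \<le>
      (1 - 1 / (1 + \<alpha>)) * G (x - 1) + (1 / (1 + \<alpha>)) * G (x + \<alpha>)"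
    by (rule convex_onD) (use assms in auto)
  also have "(1 - 1 / (1 + \<alpha>)) *\<^sub>R (x - 1) + (1 / (1 + \<alpha>)) *\<^sub>R (x + \<alpha>) = x"
  proof -
    define c where "c = 1 / (1 + \<alpha>)"
    have "c + c * \<alpha> = c * (1 + \<alpha>)"
      by (simp add: algebra_simps)
    also have "\<dots> = 1"
      using assms by (simp add: c_def)
    finally have "(1 - c) * (x - 1) + c * (x + \<alpha>) = x"
      by (simp add: algebra_simps)
    then show ?thesis
      by (simp add: c_def)
  qed
  also have "(1 - 1 / (1 + \<alpha>)) * G (x - 1) + (1 / (1 + \<alpha>)) * G (x + \<alpha>) =
      (\<alpha> * G (x - 1) + G (x + \<alpha>)) / (1 + \<alpha>)"
  proof -
    have "1 - 1 / (1 + \<alpha>) = \<alpha> / (1 + \<alpha>)"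
      using assms by (simp add: field_simps)
    then show ?thesis
      by (simp add: add_divide_distrib)
  qed
  finally have "(1 + \<alpha>) * G x \<le> \<alpha> * G (x - 1) + G (x + \<alpha>)"
    using assms by (simp add: pos_le_divide_eq mult.commute)
  moreover have "G x = ln (x - 1) + G (x - 1)"
  proof -
    have "x - 1 \<notin> \<int>\<^sub>\<le>\<^sub>0"
      using assms by (auto elim!: nonpos_Ints_cases)
    then have "Gamma x = (x - 1) * Gamma (x - 1)"
      using Gamma_plus1[of "x - 1"] by simp
    moreover have "Gamma (x - 1) \<noteq> 0"
      using assms Gamma_real_pos[of "x - 1"] by linarith
    ultimately show ?thesis
      using assms by (simp add: G_def ln_mult)
  qed
  ultimately have "G x - G (x + \<alpha>) \<le> - \<alpha> * ln (x - 1)"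
    by (simp add: algebra_simps)
  then have "exp (G x - G (x + \<alpha>)) \<le> exp (- \<alpha> * ln (x - 1))"
    by simp
  then show ?thesis
    using assms by (simp add: G_def exp_diff powr_def)
qed

text \<open>Ratio test: by \<open>Gamma_quotient_le\<close> consecutive terms have ratio at most
  \<open>x * (real k * \<alpha>) powr (- \<alpha>)\<close>, which tends to \<open>0\<close>.\<close>

lemma summable_Mittag_Leffler:
  fixes \<alpha> x :: real
  assumes "\<alpha> > 0" "x \<ge> 0"
  shows "summable (\<lambda>k. x ^ k / Gamma (real k * \<alpha> + 1))"
proof -
  have "(\<lambda>k. x * (real k * \<alpha>) powr (- \<alpha>)) \<longlonglongrightarrow> x * 0"
    using assms by (intro tendsto_intros tendsto_neg_powr filterlim_at_top_mult_tendsto_pos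
        [where c = \<alpha>] filterlim_real_sequentially) (auto simp: mult.commute)
  then have "\<forall>\<^sub>F k in sequentially. x * (real k * \<alpha>) powr (- \<alpha>) < 1/2"
    by (intro order_tendstoD) auto
  then obtain K where K: "\<And>k. k \<ge> K \<Longrightarrow> x * (real k * \<alpha>) powr (- \<alpha>) < 1/2"
    by (auto simp: eventually_sequentially)
  show ?thesis
  \<comment> \<open>Starting at \<open>Suc K\<close> forces \<open>k > 0\<close>, hence
    \<open>y > 1\<close> as the quotient bound requires.\<close>
  proof (rule summable_ratio_test[where c = "1/2" and N = "Suc K"])
    fix k assume k: "Suc K \<le> k"
    define y where "y = real k * \<alpha> + 1"
    have "y > 1"
      using k assms by (simp add: y_def)
    have pos: "Gamma y > 0" "Gamma (y + \<alpha>) > 0"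
      using \<open>y > 1\<close> assms by auto
    have "x * (Gamma y / Gamma (y + \<alpha>)) \<le> x * (y - 1) powr (- \<alpha>)"
      using Gamma_quotient_le[OF assms(1) \<open>y > 1\<close>] assms by (intro mult_left_mono)
    also have "\<dots> \<le> 1/2"
      using K[of k] k by (simp add: y_def)
    finally have "x ^ k / Gamma y * (x * (Gamma y / Gamma (y + \<alpha>))) \<le> x ^ k / Gamma y * (1/2)"
      using assms pos by (intro mult_left_mono) auto
    then have "x ^ Suc k / Gamma (y + \<alpha>) \<le> 1/2 * (x ^ k / Gamma y)"
      using pos by (simp add: field_simps)
    then show "norm (x ^ Suc k / Gamma (real (Suc k) * \<alpha> + 1)) \<le>
        1/2 * norm (x ^ k / Gamma (real k * \<alpha> + 1))"
      using assms pos by (simp add: y_def algebra_simps)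
  qed auto
qed

text \<open>One Gamma factor of the Beta value cancels the normalisation and its denominator
  supplies the next one: fractional integration moves each Mittag-Leffler term to its
  successor.\<close>

lemma has_bochner_integral_frac_kernel_powr:
  fixes \<alpha> t :: real
  assumes "\<alpha> > 0" "t > 0"
  shows "has_bochner_integral lborel
    (\<lambda>s. indicator {0<..<t} s *
      ((t - s) powr (\<alpha> - 1) * (s powr (real k * \<alpha>) / Gamma (real k * \<alpha> + 1))))
    (Gamma \<alpha> * (t powr (real (Suc k) * \<alpha>) / Gamma (real (Suc k) * \<alpha> + 1)))"
proof -
  have "has_bochner_integral lborel
      (\<lambda>s. 1 / Gamma (real k * \<alpha> + 1) * (indicator {0<..<t} s *
        ((s - 0) powr ((real k * \<alpha> + 1) - 1) * (t - s) powr (\<alpha> - 1))))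
      (1 / Gamma (real k * \<alpha> + 1) *
        (Beta (real k * \<alpha> + 1) \<alpha> * (t - 0) powr (real k * \<alpha> + 1 + \<alpha> - 1)))"
    using assms by (intro has_bochner_integral_mult_right has_bochner_integral_Beta)
      (auto intro: add_nonneg_pos)
  moreover have "1 / Gamma (real k * \<alpha> + 1) *
      (Beta (real k * \<alpha> + 1) \<alpha> * (t - 0) powr (real k * \<alpha> + 1 + \<alpha> - 1)) =
      Gamma \<alpha> * (t powr (real (Suc k) * \<alpha>) / Gamma (real (Suc k) * \<alpha> + 1))"
  proof -
    have "Gamma (real k * \<alpha> + 1) > 0"
      using assms by (intro Gamma_real_pos add_nonneg_pos) auto
    then show ?thesis
      by (simp add: Beta_def algebra_simps)
  qed
  ultimately show ?thesis
    by (simp add: mult_ac)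
qed

text \<open>The remainder after \<open>Suc K\<close> terms is the fractional integral of
  \<open>C\<close> convolved with the remainder after \<open>K\<close> terms. Each round costs a
  factor \<open>D\<close> and advances the Mittag-Leffler term by one.\<close>

lemma convolution_Volterra_sums:
  fixes p :: "nat \<Rightarrow> real \<Rightarrow> real" and C :: "real fps" and \<alpha> t :: real
  assumes "\<alpha> > 0" "t > 0"
    and cont: "\<And>n t. t > 0 \<Longrightarrow> continuous_on {0..t} (p n)"
    and bound: "\<And>n t. t > 0 \<Longrightarrow> \<bar>p n t\<bar> \<le> 1"
    and eq: "\<And>n t. t > 0 \<Longrightarrow>
      p n t = 1 $ n + frac_integral \<alpha> (\<lambda>s. \<Sum>j\<le>n. C $ j * p (n - j) s) t"
    and C: "\<And>n. (\<Sum>j\<le>n. \<bar>C $ j\<bar>) \<le> D"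
  shows "(\<lambda>k. (C ^ k) $ n * (t powr (real k * \<alpha>) / Gamma (real k * \<alpha> + 1))) sums p n t"
proof -
  define E where "E = (\<lambda>k t. t powr (real k * \<alpha>) / Gamma (real k * \<alpha> + 1))"
  have "D \<ge> 0"
    using C[of 0] by simp
  have E_nonneg: "E k t \<ge> 0" for k t
    using assms(1) unfolding E_def
    by (intro divide_nonneg_nonneg less_imp_le[OF Gamma_real_pos] add_nonneg_pos) auto
  \<comment> \<open>All \<open>n\<close> and all positive times go together, since the remainder at
    \<open>n\<close> and \<open>t\<close> involves all indices up to \<open>n\<close> and all
    earlier times.\<close>
  have "\<forall>t>0. \<forall>n. \<bar>p n t - (\<Sum>k<K. (C ^ k) $ n * E k t)\<bar> \<le> D ^ K * E K t" for K
  proof (induction K)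
    case 0
    then show ?case
      using bound by (simp add: E_def)
  next
    case (Suc K)
    show ?case
    proof (intro allI impI)
      fix t :: real and n :: nat
      assume "t > 0"
      define w where "w = (\<lambda>s. indicator {0<..<t} s * (t - s) powr (\<alpha> - 1))"
      have w_nonneg: "w s \<ge> 0" for s
        by (simp add: w_def)
      define h where "h = (\<lambda>s. \<Sum>j\<le>n. C $ j * p (n - j) s)"
      \<comment> \<open>\<open>hK\<close> is \<open>C\<close> convolved with the partial sums, which
        raises each power to \<open>Suc k\<close>.\<close>
      define hK where "hK = (\<lambda>s. \<Sum>k<K. (C ^ Suc k) $ n * E k s)"
      have diff: "h s - hK s = (\<Sum>j\<le>n. C $ j * (p (n - j) s - (\<Sum>k<K. (C ^ k) $ (n - j) * E k s)))" for s
      proof -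
        have "hK s = (\<Sum>k<K. \<Sum>j\<le>n. C $ j * ((C ^ k) $ (n - j) * E k s))"
          by (simp add: hK_def fps_mult_nth atLeast0AtMost sum_distrib_right mult.assoc)
        also have "\<dots> = (\<Sum>j\<le>n. C $ j * (\<Sum>k<K. (C ^ k) $ (n - j) * E k s))"
          by (subst sum.swap) (simp add: sum_distrib_left)
        finally show ?thesis
          by (simp add: h_def right_diff_distrib sum_subtractf)
      qed
      have h_int: "has_bochner_integral lborel (\<lambda>s. w s * h s) (Gamma \<alpha> * frac_integral \<alpha> h t)"
      proof -
        have "continuous_on {0..t} h"
          unfolding h_def using cont \<open>t > 0\<close> by (intro continuous_intros) auto
        then have "integrable lborel (\<lambda>s. w s * h s)"
          using integrable_frac_kernel[of \<alpha> t h] \<open>\<alpha> > 0\<close> \<open>t > 0\<close> by (simp add: w_def mult.assoc)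
        moreover have "Gamma \<alpha> \<noteq> 0"
          using Gamma_real_pos[of \<alpha>] \<open>\<alpha> > 0\<close> by linarith
        then have "(LINT s|lborel. w s * h s) = Gamma \<alpha> * frac_integral \<alpha> h t"
          by (simp add: frac_integral_def w_def mult.assoc)
        ultimately show ?thesis
          by (simp add: has_bochner_integral_iff)
      qed
      have E_int: "has_bochner_integral lborel (\<lambda>s. w s * E k s) (Gamma \<alpha> * E (Suc k) t)" for k
        using has_bochner_integral_frac_kernel_powr[OF \<open>\<alpha> > 0\<close> \<open>t > 0\<close>]
        by (simp only: w_def E_def mult.assoc)
      have "has_bochner_integral lborel (\<lambda>s. \<Sum>k<K. (C ^ Suc k) $ n * (w s * E k s))
          (\<Sum>k<K. (C ^ Suc k) $ n * (Gamma \<alpha> * E (Suc k) t))"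
        by (intro has_bochner_integral_sum has_bochner_integral_mult_right E_int)
      then have hK_int: "has_bochner_integral lborel (\<lambda>s. w s * hK s)
          (Gamma \<alpha> * (\<Sum>k<K. (C ^ Suc k) $ n * E (Suc k) t))"
        by (simp only: hK_def sum_distrib_left mult.left_commute)
      have diff_int: "has_bochner_integral lborel (\<lambda>s. w s * (h s - hK s))
          (Gamma \<alpha> * (frac_integral \<alpha> h t - (\<Sum>k<K. (C ^ Suc k) $ n * E (Suc k) t)))"
        using has_bochner_integral_diff[OF h_int hK_int] by (simp only: right_diff_distrib)
      have R_int: "has_bochner_integral lborel (\<lambda>s. D ^ Suc K * (w s * E K s))
          (D ^ Suc K * (Gamma \<alpha> * E (Suc K) t))"
        by (intro has_bochner_integral_mult_right E_int)
      \<comment> \<open>The induction hypothesis covers positive times; elsewhere \<open>w\<close>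
        vanishes.\<close>
      have le: "\<bar>w s * (h s - hK s)\<bar> \<le> D ^ Suc K * (w s * E K s)" for s
      proof (cases "s > 0")
        case True
        have "\<bar>h s - hK s\<bar> \<le> (\<Sum>j\<le>n. \<bar>C $ j\<bar> * (D ^ K * E K s))"
          unfolding diff using Suc.IH True
          by (intro order_trans[OF sum_abs] sum_mono) (auto simp: abs_mult intro!: mult_left_mono)
        also have "\<dots> \<le> D * (D ^ K * E K s)"
          unfolding sum_distrib_right [symmetric]
          using C[of n] \<open>D \<ge> 0\<close> E_nonneg by (intro mult_right_mono) auto
        finally show ?thesis
          using mult_left_mono[OF _ w_nonneg[of s]] w_nonneg[of s]
          by (fastforce simp: abs_mult mult_ac)
      qed (simp add: w_def)
      have "\<bar>Gamma \<alpha> * (frac_integral \<alpha> h t - (\<Sum>k<K. (C ^ Suc k) $ n * E (Suc k) t))\<bar> \<le>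
          D ^ Suc K * (Gamma \<alpha> * E (Suc K) t)"
        using Bochner_Integration.integral_norm_bound_integral[of lborel "\<lambda>s. w s * (h s - hK s)"
            "\<lambda>s. D ^ Suc K * (w s * E K s)"] diff_int R_int le
        by (simp only: has_bochner_integral_iff real_norm_def)
      then have "Gamma \<alpha> * \<bar>frac_integral \<alpha> h t - (\<Sum>k<K. (C ^ Suc k) $ n * E (Suc k) t)\<bar> \<le>
          Gamma \<alpha> * (D ^ Suc K * E (Suc K) t)"
        using \<open>\<alpha> > 0\<close> by (simp add: abs_mult mult_ac)
      then have "\<bar>frac_integral \<alpha> h t - (\<Sum>k<K. (C ^ Suc k) $ n * E (Suc k) t)\<bar> \<le>
          D ^ Suc K * E (Suc K) t"
        using \<open>\<alpha> > 0\<close> by (subst (asm) mult_le_cancel_left_pos) auto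
      \<comment> \<open>The term \<open>k = 0\<close> is \<open>1 $ n\<close> and cancels the
        initial value.\<close>
      moreover have "p n t - (\<Sum>k<Suc K. (C ^ k) $ n * E k t) =
          frac_integral \<alpha> h t - (\<Sum>k<K. (C ^ Suc k) $ n * E (Suc k) t)"
        using eq[of t n] \<open>t > 0\<close>
        by (subst sum.lessThan_Suc_shift) (simp add: h_def E_def)
      ultimately show "\<bar>p n t - (\<Sum>k<Suc K. (C ^ k) $ n * E k t)\<bar> \<le> D ^ Suc K * E (Suc K) t"
        by simp
    qed
  qed
  then have remainder: "\<bar>(\<Sum>k<K. (C ^ k) $ n * E k t) - p n t\<bar> \<le> D ^ K * E K t" for K
    using \<open>t > 0\<close> by (simp add: abs_minus_commute)
  \<comment> \<open>The bound is the general term of the Mittag-Leffler series at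
    \<open>D * t powr \<alpha>\<close>, hence tends to \<open>0\<close>.\<close>
  have "D ^ K * E K t = (D * t powr \<alpha>) ^ K / Gamma (real K * \<alpha> + 1)" for K
    using \<open>t > 0\<close>
    by (simp add: E_def power_mult_distrib powr_powr mult.commute flip: powr_realpow)
  then have "(\<lambda>K. D ^ K * E K t) \<longlonglongrightarrow> 0"
    using summable_Mittag_Leffler[of \<alpha> "D * t powr \<alpha>"] \<open>\<alpha> > 0\<close> \<open>D \<ge> 0\<close>
    by (simp add: summable_LIMSEQ_zero)
  then have "(\<lambda>K. (\<Sum>k<K. (C ^ k) $ n * E k t) - p n t) \<longlonglongrightarrow> 0"
    by (rule Lim_null_comparison[rotated]) (use remainder in auto)
  then show ?thesis
    by (simp add: sums_def E_def LIM_zero_iff)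
qed

section \<open>Power series expanded at 1\<close>

text \<open>A weighted Young inequality: \<open>z ^ n\<close> splits as
  \<open>z ^ j * z ^ (n - j)\<close>, so an l1 bound on \<open>A\<close> and a supremum bound on
  \<open>B\<close> multiply.\<close>

lemma abs_fps_mult_nth_le:
  fixes A B :: "real fps"
  assumes "\<And>n. (\<Sum>j\<le>n. \<bar>A $ j\<bar> * z ^ j) \<le> D" "\<And>n. \<bar>B $ n\<bar> * z ^ n \<le> K" "z \<ge> 0"
  shows "\<bar>(A * B) $ n\<bar> * z ^ n \<le> D * K"
proof -
  have "K \<ge> 0"
    using assms(2)[of 0] by (metis abs_ge_zero mult_1_right order_trans power_0)
  have "\<bar>(A * B) $ n\<bar> * z ^ n \<le> (\<Sum>j\<le>n. \<bar>A $ j * B $ (n - j)\<bar>) * z ^ n"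
    using assms(3) by (intro mult_right_mono) (auto simp: fps_mult_nth atLeast0AtMost)
  also have "\<dots> = (\<Sum>j\<le>n. (\<bar>A $ j\<bar> * z ^ j) * (\<bar>B $ (n - j)\<bar> * z ^ (n - j)))"
    unfolding sum_distrib_right
  proof (intro sum.cong refl)
    fix j assume "j \<in> {..n}"
    then have "z ^ n = z ^ j * z ^ (n - j)"
      by (simp flip: power_add)
    then show "\<bar>A $ j * B $ (n - j)\<bar> * z ^ n =
        (\<bar>A $ j\<bar> * z ^ j) * (\<bar>B $ (n - j)\<bar> * z ^ (n - j))"
      by (simp add: abs_mult)
  qed
  also have "\<dots> \<le> (\<Sum>j\<le>n. (\<bar>A $ j\<bar> * z ^ j) * K)"
    using assms by (intro sum_mono mult_left_mono) auto
  also have "\<dots> \<le> D * K"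
    unfolding sum_distrib_right [symmetric] using assms(1) \<open>K \<ge> 0\<close> by (intro mult_right_mono)
  finally show ?thesis .
qed

lemma abs_fps_power_nth_le:
  fixes A :: "real fps"
  assumes "\<And>n. (\<Sum>j\<le>n. \<bar>A $ j\<bar> * z ^ j) \<le> D" "z \<ge> 0"
  shows "\<bar>(A ^ k) $ n\<bar> * z ^ n \<le> D ^ k"
proof (induction k arbitrary: n)
  case 0
  then show ?case
    by simp
next
  case (Suc k)
  then show ?case
    using abs_fps_mult_nth_le[of A z D "A ^ k" "D ^ k" n] assms by simp
qed

text \<open>A single term of the expansion of \<open>(1 + \<rho>) ^ n\<close> bounds
  \<open>n choose m\<close> by \<open>(1 + \<rho>) ^ n / \<rho> ^ m\<close>; here \<rho> is small
  enough that \<open>(1 + \<rho>) * q < 1\<close>.\<close>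

lemma summable_binomial_geometric:
  fixes q :: real
  assumes "0 \<le> q" "q < 1"
  shows "summable (\<lambda>n. real (n choose m) * q ^ n)"
proof -
  obtain y where y: "q < y" "y < 1"
    using dense[OF assms(2)] by auto
  define \<rho> where "\<rho> = (1 - y) / y"
  have \<rho>: "\<rho> > 0" "(1 + \<rho>) * y = 1"
    using y assms by (auto simp: \<rho>_def field_simps)
  have le: "real (n choose m) * \<rho> ^ m \<le> (1 + \<rho>) ^ n" for n
  proof (cases "m \<le> n")
    case True
    have "(1 + \<rho>) ^ n = (\<Sum>k\<le>n. real (n choose k) * \<rho> ^ k)"
      using binomial_ring[of \<rho> 1 n] by (simp add: add.commute)
    also have "\<dots> \<ge> (\<Sum>k\<in>{m}. real (n choose k) * \<rho> ^ k)"
      using True \<rho>(1) by (intro sum_mono2) auto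
    finally show ?thesis
      by simp
  qed (use \<rho> in \<open>simp add: binomial_eq_0\<close>)
  show ?thesis
  proof (rule summable_comparison_test')
    have "(1 + \<rho>) * q < 1"
      using y \<rho> by (smt (verit) mult_strict_left_mono)
    then show "summable (\<lambda>n. 1 / \<rho> ^ m * ((1 + \<rho>) * q) ^ n)"
      using assms \<rho> by (intro summable_mult summable_geometric) auto
    fix n :: nat
    have "real (n choose m) * q ^ n \<le> (1 + \<rho>) ^ n / \<rho> ^ m * q ^ n"
      using le[of n] \<rho> assms by (intro mult_right_mono) (auto simp: field_simps)
    then show "norm (real (n choose m) * q ^ n) \<le> 1 / \<rho> ^ m * ((1 + \<rho>) * q) ^ n"
      using assms by (simp add: power_mult_distrib)
  qed
qed

lemma summable_binomial_mult:
  fixes A :: "nat \<Rightarrow> real"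
  assumes "z > 1" "\<And>n. \<bar>A n\<bar> * z ^ n \<le> K"
  shows "summable (\<lambda>n. \<bar>real (n choose m) * A n\<bar>)"
proof (rule summable_comparison_test')
  show "summable (\<lambda>n. K * (real (n choose m) * (1 / z) ^ n))"
    using assms(1) by (intro summable_mult summable_binomial_geometric) auto
  fix n
  have "\<bar>A n\<bar> \<le> K * (1 / z) ^ n"
    using assms(1) assms(2)[of n] by (simp add: field_simps power_divide)
  then have "real (n choose m) * \<bar>A n\<bar> \<le> real (n choose m) * (K * (1 / z) ^ n)"
    by (intro mult_left_mono) auto
  then show "norm \<bar>real (n choose m) * A n\<bar> \<le> K * (real (n choose m) * (1 / z) ^ n)"
    by (simp add: abs_mult mult_ac)
qed

text \<open>The Taylor series of \<open>A(1 + x)\<close> in \<open>x\<close>, by the binomial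
  theorem; it has this meaning when the series of coefficients converge.\<close>

definition fps_expand_at_1 :: "real fps \<Rightarrow> real fps" where
  "fps_expand_at_1 A = Abs_fps (\<lambda>m. \<Sum>n. real (n choose m) * A $ n)"

text \<open>Absolute convergence allows Cauchy products, and Vandermonde's identity collapses the
  products of binomials.\<close>

lemma fps_expand_at_1_mult:
  assumes A: "\<And>m. summable (\<lambda>n. \<bar>real (n choose m) * A $ n\<bar>)"
    and B: "\<And>m. summable (\<lambda>n. \<bar>real (n choose m) * B $ n\<bar>)"
  shows "fps_expand_at_1 (A * B) = fps_expand_at_1 A * fps_expand_at_1 B"
proof (rule fps_ext)
  fix r
  have "(\<lambda>n. \<Sum>i\<le>n. (real (i choose m) * A $ i) * (real ((n - i) choose (r - m)) * B $ (n - i)))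
      sums (fps_expand_at_1 A $ m * fps_expand_at_1 B $ (r - m))" for m
    unfolding fps_expand_at_1_def fps_nth_Abs_fps
    using A B by (intro Cauchy_product_sums) (simp_all only: real_norm_def)
  then have "(\<lambda>n. \<Sum>m\<le>r. \<Sum>i\<le>n. (real (i choose m) * A $ i) * (real ((n - i) choose (r - m)) * B $ (n - i)))
      sums (\<Sum>m\<le>r. fps_expand_at_1 A $ m * fps_expand_at_1 B $ (r - m))"
    by (intro sums_sum)
  also have "(\<lambda>n. \<Sum>m\<le>r. \<Sum>i\<le>n. (real (i choose m) * A $ i) * (real ((n - i) choose (r - m)) * B $ (n - i)))
      = (\<lambda>n. real (n choose r) * (A * B) $ n)"
  proof
    fix n
    have "(\<Sum>m\<le>r. \<Sum>i\<le>n. (real (i choose m) * A $ i) * (real ((n - i) choose (r - m)) * B $ (n - i))) =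
        (\<Sum>i\<le>n. real (\<Sum>m\<le>r. (i choose m) * ((n - i) choose (r - m))) * (A $ i * B $ (n - i)))"
      by (subst sum.swap) (simp add: sum_distrib_right sum_distrib_left mult_ac)
    also have "\<dots> = real (n choose r) * (A * B) $ n"
      by (simp add: vandermonde fps_mult_nth sum_distrib_left atLeast0AtMost)
    finally show "(\<Sum>m\<le>r. \<Sum>i\<le>n. (real (i choose m) * A $ i) * (real ((n - i) choose (r - m)) * B $ (n - i))) =
      real (n choose r) * (A * B) $ n" .
  qed
  finally show "fps_expand_at_1 (A * B) $ r = (fps_expand_at_1 A * fps_expand_at_1 B) $ r"
    by (simp add: sums_iff fps_mult_nth atLeast0AtMost fps_expand_at_1_def)
qed

text \<open>Every power inherits geometric decay from the weight \<open>z > 1\<close>, so the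
  product rule applies at each step.\<close>

lemma fps_expand_at_1_power:
  assumes "\<And>n. (\<Sum>j\<le>n. \<bar>A $ j\<bar> * z ^ j) \<le> D" "z > 1"
  shows "fps_expand_at_1 (A ^ k) = fps_expand_at_1 A ^ k"
proof (induction k)
  case 0
  have "(\<Sum>n. real (n choose m) * (1 :: real fps) $ n) = (1 :: real fps) $ m" for m
    using suminf_finite[of "{0}" "\<lambda>n. real (n choose m) * (1 :: real fps) $ n"] by auto
  then show ?case
    by (auto simp: fps_expand_at_1_def intro!: fps_ext)
next
  case (Suc k)
  have "summable (\<lambda>n. \<bar>real (n choose m) * (A ^ i) $ n\<bar>)" for m i
    using assms by (intro summable_binomial_mult[of z _ "D ^ i"] abs_fps_power_nth_le) auto
  from this[of _ k] this[of _ 1] show ?case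
    using Suc fps_expand_at_1_mult[of A "A ^ k"] by simp
qed

text \<open>Converts the lists of length \<open>k\<close> and sum \<open>r\<close> in
  \<open>fps_power_nth\<close> into the functions on \<open>{1..k}\<close> that serve as
  multi-indices in the theorem.\<close>

lemma fps_power_nth_PiE:
  fixes A :: "'a :: comm_ring_1 fps"
  assumes "k > 0"
  shows "(A ^ k) $ r = (\<Sum>m\<in>{m \<in> {1..k} \<rightarrow>\<^sub>E (UNIV :: nat set). (\<Sum>l=1..k. m l) = r}. \<Prod>l=1..k. A $ m l)"
proof -
  obtain h where h: "k = Suc h"
    using assms by (cases k) auto
  have "(A ^ k) $ r = (\<Sum>v\<in>natpermute r k. \<Prod>j=0..h. A $ (v ! j))"
    using fps_power_nth[of A k r] h by simp
  also have "\<dots> = (\<Sum>m\<in>{m \<in> {1..k} \<rightarrow>\<^sub>E (UNIV :: nat set). (\<Sum>l=1..k. m l) = r}. \<Prod>l=1..k. A $ m l)"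
  \<comment> \<open>Lists are indexed from \<open>0\<close> and the functions from \<open>1\<close>,
    hence \<open>l - 1\<close>.\<close>
  proof (rule sum.reindex_bij_witness[where i = "\<lambda>m. map m [1..<Suc k]"
        and j = "\<lambda>v. \<lambda>l\<in>{1..k}. v ! (l - 1)"])
    fix v assume v: "v \<in> natpermute r k"
    show "map (\<lambda>l\<in>{1..k}. v ! (l - 1)) [1..<Suc k] = v"
      using v by (intro nth_equalityI) (auto simp: natpermute_def simp del: upt_Suc)
    have shift: "{1..k} = Suc ` {0..<k}"
      by (simp add: image_Suc_atLeastLessThan atLeastLessThanSuc_atLeastAtMost)
    have "(\<Sum>l=1..k. (\<lambda>l\<in>{1..k}. v ! (l - 1)) l) = (\<Sum>l=0..<k. v ! l)"
      unfolding shift by (subst sum.reindex) auto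
    also have "\<dots> = r"
      using v by (auto simp: natpermute_def sum_list_sum_nth)
    finally show "(\<lambda>l\<in>{1..k}. v ! (l - 1)) \<in>
        {m \<in> {1..k} \<rightarrow>\<^sub>E (UNIV :: nat set). (\<Sum>l=1..k. m l) = r}"
      by auto
    show "(\<Prod>l=1..k. A $ (\<lambda>l\<in>{1..k}. v ! (l - 1)) l) = (\<Prod>j=0..h. A $ (v ! j))"
      unfolding shift by (subst prod.reindex) (auto simp: h atLeastLessThanSuc_atLeastAtMost)
  next
    fix m assume m: "m \<in> {m \<in> {1..k} \<rightarrow>\<^sub>E (UNIV :: nat set). (\<Sum>l=1..k. m l) = r}"
    show "(\<lambda>l\<in>{1..k}. map m [1..<Suc k] ! (l - 1)) = m"
      using m by (auto simp: fun_eq_iff PiE_def extensional_def restrict_def simp del: upt_Suc)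
    have "sum_list (map m [1..<Suc k]) = (\<Sum>l=1..k. m l)"
      by (simp only: sum_set_upt_conv_sum_list_nat [symmetric] set_upt
          atLeastLessThanSuc_atLeastAtMost)
    then show "map m [1..<Suc k] \<in> natpermute r k"
      using m by (simp add: natpermute_def del: upt_Suc)
  qed
  finally show ?thesis .
qed

section \<open>Factorial moments\<close>

lemma falling_factorial_eq_binomial:
  "falling_factorial (real n) m = fact m * real (n choose m)"
  by (simp add: falling_factorial_def binomial_gbinomial gbinomial_prod_rev lessThan_atLeast0)

text \<open>The majorant \<open>a k * b n\<close> is summable over all pairs, so \<open>f\<close> is
  absolutely summable there and the order of summation is free.\<close>

lemma sums_swap_product_bound:
  fixes f :: "nat \<Rightarrow> nat \<Rightarrow> real"
  assumes le: "\<And>k n. \<bar>f k n\<bar> \<le> a k * b n"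
    and "summable a" "summable b" "\<And>k. a k \<ge> 0" "\<And>n. b n \<ge> 0"
  shows "(\<lambda>n. \<Sum>k. f k n) sums (\<Sum>k. \<Sum>n. f k n)"
proof -
  \<comment> \<open>\<open>infsum\<close> and \<open>suminf\<close> agree under absolute
    convergence, which is therefore checked for all inner and outer series.\<close>
  have inf_sum: "infsum g UNIV = (\<Sum>n. g n)" if "summable (\<lambda>n. \<bar>g n\<bar>)" for g :: "nat \<Rightarrow> real"
    using that summable_sums[OF summable_rabs_cancel[OF that]]
    by (intro infsumI norm_summable_imp_has_sum) (simp only: real_norm_def)
  have sum_k: "summable (\<lambda>k. \<bar>f k n\<bar>)" for n
    by (rule summable_comparison_test'[of "\<lambda>k. a k * b n" 0])
      (use le \<open>summable a\<close> in \<open>auto intro: summable_mult summable_mult2\<close>)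
  have sum_n: "summable (\<lambda>n. \<bar>f k n\<bar>)" for k
    by (rule summable_comparison_test'[of "\<lambda>n. a k * b n" 0])
      (use le \<open>summable b\<close> in \<open>auto intro: summable_mult summable_mult2\<close>)
  have le_k: "\<bar>\<Sum>k. f k n\<bar> \<le> suminf a * b n" for n
  proof -
    have "\<bar>\<Sum>k. f k n\<bar> \<le> (\<Sum>k. \<bar>f k n\<bar>)"
      using sum_k by (rule summable_rabs)
    also have "\<dots> \<le> (\<Sum>k. a k * b n)"
      using le sum_k \<open>summable a\<close> by (intro suminf_le summable_mult summable_mult2) auto
    finally show ?thesis
      using \<open>summable a\<close> by (simp add: suminf_mult2)
  qed
  have le_n: "\<bar>\<Sum>n. f k n\<bar> \<le> a k * suminf b" for k
  proof -
    have "\<bar>\<Sum>n. f k n\<bar> \<le> (\<Sum>n. \<bar>f k n\<bar>)"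
      using sum_n by (rule summable_rabs)
    also have "\<dots> \<le> (\<Sum>n. a k * b n)"
      using le sum_n \<open>summable b\<close> by (intro suminf_le summable_mult summable_mult2) auto
    finally show ?thesis
      using \<open>summable b\<close> by (simp add: suminf_mult)
  qed
  have outer_n: "summable (\<lambda>n. \<bar>\<Sum>k. f k n\<bar>)"
    by (rule summable_comparison_test'[of "\<lambda>n. suminf a * b n" 0])
      (use le_k \<open>summable b\<close> in \<open>auto intro: summable_mult summable_mult2\<close>)
  have outer_k: "summable (\<lambda>k. \<bar>\<Sum>n. f k n\<bar>)"
    by (rule summable_comparison_test'[of "\<lambda>k. a k * suminf b" 0])
      (use le_n \<open>summable a\<close> in \<open>auto intro: summable_mult summable_mult2\<close>)
  have "(\<lambda>(k, n). a k * b n) summable_on (UNIV \<times> UNIV)"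
  proof (rule summable_on_SigmaI)
    show "((\<lambda>n. (\<lambda>(k, n). a k * b n) (k, n)) has_sum (a k * suminf b)) UNIV" for k
      unfolding prod.case using assms
      by (intro sums_nonneg_imp_has_sum sums_mult summable_sums) auto
    show "(\<lambda>k. a k * suminf b) summable_on UNIV"
      using assms by (intro summable_nonneg_imp_summable_on summable_mult2)
        (auto intro!: mult_nonneg_nonneg suminf_nonneg)
  qed (use assms in auto)
  then have "(\<lambda>x. norm (case x of (k, n) \<Rightarrow> f k n)) summable_on (UNIV \<times> UNIV)"
    by (rule Infinite_Sum.abs_summable_on_comparison_test') (use le in auto)
  then have "(\<lambda>(k, n). f k n) summable_on (UNIV \<times> UNIV)"
    by (rule abs_summable_summable)
  from infsum_swap_banach[OF this]
  have "(\<Sum>k. \<Sum>n. f k n) = (\<Sum>n. \<Sum>k. f k n)"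
    by (simp only: inf_sum[OF sum_n] inf_sum[OF sum_k] inf_sum[OF outer_n] inf_sum[OF outer_k])
  then show ?thesis
    using summable_rabs_cancel[OF outer_n] by (simp add: sums_iff)
qed

text \<open>\<open>f (X \<omega>)\<close> is a series of multiples of indicators of the level sets
  of \<open>X\<close>. The hypothesis makes the integrals of their norms summable, so sum and
  integral commute.\<close>

lemma (in prob_space) integral_nat_valued:
  fixes f :: "nat \<Rightarrow> real"
  assumes X [measurable]: "X \<in> measurable M (count_space UNIV)"
    and sum: "summable (\<lambda>n. \<bar>f n\<bar> * prob {\<omega> \<in> space M. X \<omega> = n})"
  shows "integrable M (\<lambda>\<omega>. f (X \<omega>))"
    and "(LINT \<omega>|M. f (X \<omega>)) = (\<Sum>n. f n * prob {\<omega> \<in> space M. X \<omega> = n})"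
proof -
  define S where "S = (\<lambda>n. {\<omega> \<in> space M. X \<omega> = n})"
  have [measurable]: "S n \<in> sets M" for n
    unfolding S_def by measurable
  define g where "g = (\<lambda>n \<omega>. f n * indicator (S n) \<omega>)"
  have g_sums: "(\<lambda>n. g n \<omega>) sums f (X \<omega>)" if "\<omega> \<in> space M" for \<omega>
    using that sums_single[of "X \<omega>" f]
    by (auto simp: g_def S_def indicator_def if_distrib mult_delta_right eq_commute cong: if_cong
        elim!: sums_cong[THEN iffD1, rotated])
  have g_int: "integrable M (g n)" for n
    by (auto simp: g_def emeasure_eq_measure)
  have LINT_g: "(LINT \<omega>|M. g n \<omega>) = f n * prob (S n)" for n
    by (simp add: g_def)
  have norm_g: "norm (g n \<omega>) = \<bar>f n\<bar> * indicator (S n) \<omega>" for n \<omega>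
    by (simp add: g_def abs_mult)
  have sum_norm: "AE \<omega> in M. summable (\<lambda>n. norm (g n \<omega>))"
    by (intro AE_I2 summable_finite[of "{X _}"]) (auto simp: g_def S_def indicator_def)
  have sum_LINT: "summable (\<lambda>n. LINT \<omega>|M. norm (g n \<omega>))"
    using sum by (simp only: norm_g) (simp add: S_def)
  note suminf = integrable_suminf[OF g_int sum_norm sum_LINT] integral_suminf[OF g_int sum_norm sum_LINT]
  have eq: "(\<Sum>n. g n \<omega>) = f (X \<omega>)" if "\<omega> \<in> space M" for \<omega>
    using g_sums[OF that] by (rule sums_unique [symmetric])
  show "integrable M (\<lambda>\<omega>. f (X \<omega>))"
    using suminf(1) eq by (simp cong: Bochner_Integration.integrable_cong)
  show "(LINT \<omega>|M. f (X \<omega>)) = (\<Sum>n. f n * prob {\<omega> \<in> space M. X \<omega> = n})"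
    using suminf(2) eq by (simp add: LINT_g S_def cong: Bochner_Integration.integral_cong)
qed

section \<open>Intensities and their increments\<close>

context intensity_parameters
begin

text \<open>As a formal power series it turns convolution in the state variable into multiplication.
  With \<open>L(u)\<close> the generating function of the intensities, it is
  \<open>(u - 1) * L(u)\<close>.\<close>

definition increments :: "real fps" where
  "increments = Abs_fps (\<lambda>j. lam (int j - 1) - lam (int j))"

lemma lam_nonneg: "lam j \<ge> 0"
  using neg_zero[of j] zero_pos nonneg[of j] by (cases j "0 :: int" rule: linorder_cases) auto

text \<open>A ratio \<open>q\<close> between the limit and \<open>1\<close> eventually dominates
  every step; monotonicity covers the finitely many earlier indices.\<close>

lemma geometric_decay: "\<exists>q A. 0 < q \<and> q < 1 \<and> A \<ge> 0 \<and> (\<forall>j. lam (int j) \<le> A * q ^ j)"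
proof -
  have "\<exists>q. 0 < q \<and> q < 1 \<and> (\<forall>\<^sub>F j in sequentially. lam (int j + 1) \<le> q * lam (int j))"
    using ratio_limit
  proof
    assume "\<exists>L<1. (\<lambda>j. lam (int j + 1) / lam (int j)) \<longlonglongrightarrow> L"
    then obtain L where L: "L < 1" "(\<lambda>j. lam (int j + 1) / lam (int j)) \<longlonglongrightarrow> L"
      by blast
    \<comment> \<open>The maximum with \<open>0\<close> secures \<open>q > 0\<close>, so that powers
      of \<open>q\<close> may be divided by.\<close>
    obtain q where q: "max L 0 < q" "q < 1"
      using dense[of "max L 0" 1] L(1) by auto
    have "\<forall>\<^sub>F j in sequentially. lam (int j + 1) / lam (int j) < q"
      using L(2) q by (intro order_tendstoD) auto
    then have "\<forall>\<^sub>F j in sequentially. lam (int j + 1) \<le> q * lam (int j)"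
    proof eventually_elim
      case (elim j)
      show ?case
      \<comment> \<open>At a zero of \<open>lam\<close> the quotient is \<open>0\<close> by
        convention and carries no information; monotonicity gives the bound instead.\<close>
      proof (cases "lam (int j) = 0")
        case True
        then show ?thesis
          using nonincreasing[of "int j" "int j + 1"] by simp
      next
        case False
        then have "lam (int j) > 0"
          using lam_nonneg[of "int j"] by simp
        then show ?thesis
          using elim by (simp add: field_simps)
      qed
    qed
    then show ?thesis
      using q by auto
  next
    assume "\<forall>\<^sub>F j in sequentially. lam (int j) = 0"
    then have "\<forall>\<^sub>F j in sequentially. lam (int j + 1) \<le> 1 / 2 * lam (int j)"
    proof eventually_elim
      case (elim j)
      then show ?case
        using nonincreasing[of "int j" "int j + 1"] by simp
    qed
    then show ?thesis
      by (intro exI[of _ "1 / 2"]) auto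
  qed
  then obtain q J where q: "0 < q" "q < 1"
    and J: "\<And>j. j \<ge> J \<Longrightarrow> lam (int j + 1) \<le> q * lam (int j)"
    by (auto simp: eventually_sequentially)
  have le: "lam (int j) \<le> lam 0" for j
    by (intro nonincreasing) auto
  \<comment> \<open>The factor \<open>1 / q ^ J\<close> lifts the bound to at least
    \<open>lam 0\<close> for all \<open>j\<close> up to \<open>J\<close>.\<close>
  have "lam (int j) \<le> lam 0 / q ^ J * q ^ j" for j
  proof (cases "J \<le> j")
    case True
    then show ?thesis
    proof (induction j rule: dec_induct)
      case base
      then show ?case
        using le q by simp
    next
      case (step j)
      have "lam (int (Suc j)) \<le> q * lam (int j)"
        using J[OF step.hyps(1)] by (simp add: add.commute)
      also have "\<dots> \<le> q * (lam 0 / q ^ J * q ^ j)"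
        using step.IH q by (intro mult_left_mono) auto
      finally show ?case
        by (simp add: mult_ac)
    qed
  next
    case False
    then have "q ^ J \<le> q ^ j"
      using q by (intro power_decreasing) auto
    then have "lam 0 * 1 \<le> lam 0 * (q ^ j / q ^ J)"
      using q zero_pos by (intro mult_left_mono) auto
    then show ?thesis
      using le[of j] by simp
  qed
  then show ?thesis
    using q zero_pos by (intro exI[of _ q] exI[of _ "lam 0 / q ^ J"]) auto
qed

text \<open>Telescoping from \<open>lam (- 1) = 0\<close> to the limit \<open>0\<close> of the
  intensities. This is \<open>C(1) = 0\<close>.\<close>

lemma sums_increments: "(\<lambda>j. increments $ j) sums 0"
proof -
  obtain q A where qA: "0 < q" "q < 1" "\<And>j. lam (int j) \<le> A * q ^ j"
    using geometric_decay by blast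
  have "(\<lambda>j. A * q ^ j) \<longlonglongrightarrow> A * 0"
    using qA by (intro tendsto_intros LIMSEQ_realpow_zero) auto
  then have lim: "(\<lambda>j. A * q ^ j) \<longlonglongrightarrow> 0"
    by simp
  have "(\<lambda>j. lam (int j)) \<longlonglongrightarrow> 0"
    by (rule Lim_null_comparison[OF _ lim]) (use qA lam_nonneg in auto)
  then have "(\<lambda>j. lam (int j - 1)) \<longlonglongrightarrow> 0"
    by (intro LIMSEQ_imp_Suc[of "\<lambda>j. lam (int j - 1)"]) simp
  from telescope_sums'[OF this] show ?thesis
    using neg_zero[of "-1"] by (simp add: increments_def)
qed

text \<open>For positive \<open>j\<close> monotonicity bounds the increment by the preceding
  intensity, so it decays like \<open>q ^ j\<close>, and any \<open>z\<close> between
  \<open>1\<close> and \<open>1 / q\<close> leaves a convergent geometric series.\<close>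

lemma weighted_increments_bounded: "\<exists>z>1. \<exists>D. \<forall>n. (\<Sum>j\<le>n. \<bar>increments $ j\<bar> * z ^ j) \<le> D"
proof -
  obtain q A where qA: "0 < q" "q < 1" "A \<ge> 0" "\<And>j. lam (int j) \<le> A * q ^ j"
    using geometric_decay by blast
  have abs_le: "\<bar>increments $ j\<bar> \<le> A / q * q ^ j" for j
  \<comment> \<open>The increment at \<open>0\<close> is \<open>- lam 0\<close>, with no positive
    predecessor; the slack \<open>A \<le> A / q\<close> takes care of it.\<close>
  proof (cases j)
    case 0
    have "A \<le> A / q"
      using qA by (simp add: field_simps mult_left_le)
    then show ?thesis
      using 0 qA(4)[of 0] lam_nonneg[of 0] neg_zero[of "-1"] by (simp add: increments_def)
  next
    case (Suc i)
    have "lam (int j) \<le> lam (int i)"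
      using Suc by (intro nonincreasing) auto
    then have "\<bar>increments $ j\<bar> \<le> lam (int i)"
      using Suc lam_nonneg[of "int j"] by (simp add: increments_def)
    also have "\<dots> \<le> A / q * q ^ j"
      using qA Suc by simp
    finally show ?thesis .
  qed
  obtain z where z: "1 < z" "z < 1 / q"
    using dense[of 1 "1 / q"] qA by auto
  then have qz: "q * z < 1"
    using qA by (simp add: field_simps)
  have "(\<Sum>j\<le>n. \<bar>increments $ j\<bar> * z ^ j) \<le> A / q * (\<Sum>j. (q * z) ^ j)" for n
  proof -
    have "(\<Sum>j\<le>n. \<bar>increments $ j\<bar> * z ^ j) \<le> (\<Sum>j\<le>n. A / q * (q * z) ^ j)"
    proof (rule sum_mono)
      fix j
      have "\<bar>increments $ j\<bar> * z ^ j \<le> A / q * q ^ j * z ^ j"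
        using abs_le[of j] z by (intro mult_right_mono) auto
      then show "\<bar>increments $ j\<bar> * z ^ j \<le> A / q * (q * z) ^ j"
        by (simp add: power_mult_distrib)
    qed
    also have "\<dots> = A / q * (\<Sum>j\<le>n. (q * z) ^ j)"
      by (simp add: sum_distrib_left)
    also have "\<dots> \<le> A / q * (\<Sum>j. (q * z) ^ j)"
      using qA z qz by (intro mult_left_mono sum_le_suminf summable_geometric) auto
    finally show ?thesis .
  qed
  then show ?thesis
    using z by blast
qed

text \<open>Outside the range one of \<open>lam\<close> and \<open>b\<close> has a negative argument
  and vanishes. Both shifts \<open>s = 0\<close> and \<open>s = 1\<close> get the same index range,
  so the two convolutions can be subtracted termwise; for \<open>s = 1\<close> the term
  \<open>j = 0\<close> is zero.\<close>

lemma discrete_conv_shift_eq_sum: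
  assumes "\<And>i. i < 0 \<Longrightarrow> b i = 0" "s \<ge> 0"
  shows "discrete_conv lam b (int n - s) = (\<Sum>j\<le>n. lam (int j - s) * b (int (n - j)))"
proof -
  have "discrete_conv lam b (int n - s) =
      (\<Sum>\<^sub>\<infinity>i\<in>(\<lambda>j. int j - s) ` {..n}. lam i * b (int n - s - i))"
    unfolding discrete_conv_def
  proof (rule infsum_cong_neutral)
    fix i assume i: "i \<in> UNIV - (\<lambda>j. int j - s) ` {..n}"
    show "lam i * b (int n - s - i) = 0"
    proof (cases "i + s \<in> {0..int n}")
      case True
      then have "i = int (nat (i + s)) - s" "nat (i + s) \<le> n"
        by auto
      then show ?thesis
        using i by blast
    next
      case False
      then show ?thesis
        using assms neg_zero[of i] by auto
    qed
  qed auto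
  also have "\<dots> = (\<Sum>j\<le>n. lam (int j - s) * b (int n - s - (int j - s)))"
    by (simp add: sum.reindex inj_on_def)
  also have "\<dots> = (\<Sum>j\<le>n. lam (int j - s) * b (int (n - j)))"
    by (intro sum.cong) (auto simp: of_nat_diff)
  finally show ?thesis .
qed

end

section \<open>State probabilities and binomial moments of the process\<close>

context convoluted_fractional_poisson_process
begin

lemma caputo_deriv_state_prob:
  assumes "t > 0"
  shows "caputo_deriv \<alpha> (state_prob M N (int n)) t =
    (\<Sum>j\<le>n. increments $ j * state_prob M N (int (n - j)) t)"
proof -
  have neg: "state_prob M N i t = 0" if "i < 0" for i
  proof -
    have "{\<omega> \<in> space M. int (N t \<omega>) = i} = {}"
      using that by auto
    then show ?thesis
      by (simp only: state_prob_def measure_empty)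
  qed
  \<comment> \<open>Writing \<open>int n - 0\<close> lets one lemma rewrite both
    convolutions.\<close>
  have "caputo_deriv \<alpha> (state_prob M N (int n)) t =
      - discrete_conv lam (\<lambda>i. state_prob M N i t) (int n - 0)
      + discrete_conv lam (\<lambda>i. state_prob M N i t) (int n - 1)"
    using governing_equation[of "int n" t] assms by simp
  also have "\<dots> = (\<Sum>j\<le>n. increments $ j * state_prob M N (int (n - j)) t)"
    using neg by (subst (1 2) discrete_conv_shift_eq_sum)
      (auto simp: increments_def left_diff_distrib sum_subtractf)
  finally show ?thesis .
qed

text \<open>Caputo inversion yields the Volterra system, the initial law is the coefficient sequence
  of the series \<open>1\<close>, and probabilities are bounded by \<open>1\<close>.\<close>

lemma state_prob_sums:
  assumes "t > 0"
  shows "(\<lambda>k. (increments ^ k) $ n * (t powr (real k * \<alpha>) / Gamma (real k * \<alpha> + 1)))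
    sums state_prob M N (int n) t"
proof -
  obtain z D where z: "z > 1" and D: "\<And>n. (\<Sum>j\<le>n. \<bar>increments $ j\<bar> * z ^ j) \<le> D"
    using weighted_increments_bounded by blast
  have cont: "continuous_on {0..t} (state_prob M N (int n))" if "t > 0" for n t
    using differentiable[of "int n" t] that by (simp add: caputo_differentiable_def)
  show ?thesis
  proof (rule convolution_Volterra_sums[where p = "\<lambda>n. state_prob M N (int n)" and D = D])
    fix n and t :: real assume "t > 0"
    have "continuous_on {0..t} (\<lambda>s. \<Sum>j\<le>n. increments $ j * state_prob M N (int (n - j)) s)"
      by (intro continuous_intros cont \<open>t > 0\<close>)
    then have "state_prob M N (int n) t = state_prob M N (int n) 0 +
        frac_integral \<alpha> (\<lambda>s. \<Sum>j\<le>n. increments $ j * state_prob M N (int (n - j)) s) t"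
      using order \<open>t > 0\<close>
      by (intro caputo_inversion differentiable caputo_deriv_state_prob) auto
    moreover have "state_prob M N (int n) 0 = 1 $ n"
      using initial_zero initial_pos[of "int n"] by (cases "n = 0") auto
    ultimately show "state_prob M N (int n) t = 1 $ n +
        frac_integral \<alpha> (\<lambda>s. \<Sum>j\<le>n. increments $ j * state_prob M N (int (n - j)) s) t"
      by simp
  next
    fix n
    have "(\<Sum>j\<le>n. \<bar>increments $ j\<bar>) \<le> (\<Sum>j\<le>n. \<bar>increments $ j\<bar> * z ^ j)"
      using z by (intro sum_mono) (simp add: mult_le_cancel_left1)
    then show "(\<Sum>j\<le>n. \<bar>increments $ j\<bar>) \<le> D"
      using D[of n] by simp
  qed (use assms order cont in \<open>auto simp: state_prob_def\<close>)
qed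

text \<open>The series of \<open>state_prob_sums\<close> is inserted and summed over
  \<open>n\<close> first; each power of \<open>increments\<close> then contributes a Taylor
  coefficient at 1.\<close>

lemma binomial_moment_sums:
  assumes "t > 0" "r \<ge> 1"
  shows "(\<lambda>n. real (n choose r) * state_prob M N (int n) t) sums
    (\<Sum>k=1..r. t powr (real k * \<alpha>) / Gamma (real k * \<alpha> + 1) * (fps_expand_at_1 increments ^ k) $ r)"
proof -
  obtain z D where z: "z > 1" and D: "\<And>n. (\<Sum>j\<le>n. \<bar>increments $ j\<bar> * z ^ j) \<le> D"
    using weighted_increments_bounded by blast
  define E where "E = (\<lambda>k. t powr (real k * \<alpha>) / Gamma (real k * \<alpha> + 1))"
  have E_nonneg: "E k \<ge> 0" for k
    using order unfolding E_def
    by (intro divide_nonneg_nonneg less_imp_le[OF Gamma_real_pos] add_nonneg_pos) auto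
  have "D \<ge> 0"
    using D[of 0] by simp
  have coeff_le: "\<bar>(increments ^ k) $ n\<bar> * z ^ n \<le> D ^ k" for k n
    using D z by (intro abs_fps_power_nth_le) auto
  define f where "f = (\<lambda>k n. real (n choose r) * ((increments ^ k) $ n * E k))"
  have "(\<lambda>n. \<Sum>k. f k n) sums (\<Sum>k. \<Sum>n. f k n)"
  proof (rule sums_swap_product_bound)
    \<comment> \<open>The coefficient bound \<open>D ^ k / z ^ n\<close> separates the variables: a
      Mittag-Leffler term in \<open>k\<close>, a binomial times a geometric term in
      \<open>n\<close>.\<close>
    show "\<bar>f k n\<bar> \<le> (E k * D ^ k) * (real (n choose r) * (1 / z) ^ n)" for k n
    proof -
      have "\<bar>(increments ^ k) $ n\<bar> \<le> D ^ k * (1 / z) ^ n"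
        using coeff_le[of k n] z by (simp add: field_simps power_divide)
      then have "real (n choose r) * E k * \<bar>(increments ^ k) $ n\<bar> \<le>
          real (n choose r) * E k * (D ^ k * (1 / z) ^ n)"
        using E_nonneg by (intro mult_left_mono) auto
      then show ?thesis
        using E_nonneg by (simp add: f_def abs_mult mult_ac)
    qed
    have "E k * D ^ k = (D * t powr \<alpha>) ^ k / Gamma (real k * \<alpha> + 1)" for k
      using \<open>t > 0\<close>
      by (simp add: E_def power_mult_distrib powr_powr mult.commute flip: powr_realpow)
    then show "summable (\<lambda>k. E k * D ^ k)"
      using summable_Mittag_Leffler[of \<alpha> "D * t powr \<alpha>"] order \<open>D \<ge> 0\<close> by simp
    show "summable (\<lambda>n. real (n choose r) * (1 / z) ^ n)"
      using z by (intro summable_binomial_geometric) auto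
  qed (use z E_nonneg \<open>D \<ge> 0\<close> in auto)
  moreover have "(\<Sum>k. f k n) = real (n choose r) * state_prob M N (int n) t" for n
    using sums_mult[OF state_prob_sums[OF assms(1)]] by (simp add: f_def E_def sums_iff)
  moreover have "(\<Sum>k. \<Sum>n. f k n) = (\<Sum>k=1..r. E k * (fps_expand_at_1 increments ^ k) $ r)"
  proof -
    have inner: "(\<Sum>n. f k n) = E k * (fps_expand_at_1 increments ^ k) $ r" for k
    proof -
      have "summable (\<lambda>n. real (n choose r) * (increments ^ k) $ n)"
        using z coeff_le
        by (intro summable_rabs_cancel[OF summable_binomial_mult[of z _ "D ^ k"]]) auto
      from suminf_mult[OF this, of "E k"]
      have "(\<Sum>n. f k n) = E k * fps_expand_at_1 (increments ^ k) $ r"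
        by (simp add: f_def fps_expand_at_1_def mult_ac)
      then show ?thesis
        using fps_expand_at_1_power[OF D z] by simp
    qed
    \<comment> \<open>Without constant term, the \<open>k\<close>-th power starts in degree
      \<open>k\<close> or later, which removes \<open>k > r\<close>; \<open>k = 0\<close> drops out
      because \<open>r\<close> is positive.\<close>
    have "fps_expand_at_1 increments $ 0 = 0"
      using sums_increments by (simp add: fps_expand_at_1_def sums_iff)
    then have "(fps_expand_at_1 increments ^ k) $ r = 0" if "k \<notin> {1..r}" for k
      using that \<open>r \<ge> 1\<close> startsby_zero_power_prefix[of "fps_expand_at_1 increments" k]
      by (cases "k = 0") auto
    then show ?thesis
      unfolding inner by (intro suminf_finite) auto
  qed
  ultimately show ?thesis
    by (simp add: E_def)
qed

end

text \<open>Integral and infinite sum are total functions, so integrability and summability are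
  asserted too; \<open>m \<le> r\<close> reaches every \<open>m l\<close>, as these sum to
  \<open>r\<close>.\<close>

theorem proposition3p3:
  fixes M :: "'a measure" and lam :: "int \<Rightarrow> real" and \<alpha> :: real
    and N :: "real \<Rightarrow> 'a \<Rightarrow> nat" and r :: nat and t :: real
  assumes "convoluted_fractional_poisson_process M lam \<alpha> N"
    and "r \<ge> 1" and "t \<ge> 0"
  shows "integrable M (\<lambda>\<omega>. falling_factorial (real (N t \<omega>)) r) \<and>
    (\<forall>m\<le>r. summable (\<lambda>j::nat. falling_factorial (real j) m * (lam (int j - 1) - lam (int j)))) \<and>
    factorial_moment M (N t) r =
      fact r * (\<Sum>k=1..r. t powr (real k * \<alpha>) / Gamma (real k * \<alpha> + 1) *
        (\<Sum>m \<in> {m \<in> {1..k} \<rightarrow>\<^sub>E (UNIV :: nat set). (\<Sum>l=1..k. m l) = r}.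
          (\<Prod>l=1..k. 1 / fact (m l) *
            (\<Sum>j::nat. falling_factorial (real j) (m l) * (lam (int j - 1) - lam (int j))))))"
proof -
  interpret convoluted_fractional_poisson_process M lam \<alpha> N
    by (fact assms(1))
  obtain z D where z: "z > 1" and D: "\<And>n. (\<Sum>j\<le>n. \<bar>increments $ j\<bar> * z ^ j) \<le> D"
    using weighted_increments_bounded by blast
  have "\<bar>increments $ n\<bar> * z ^ n \<le> D" for n
    using abs_fps_power_nth_le[of increments z D 1 n] D z by simp
  then have summable_choose: "summable (\<lambda>j. real (j choose m) * increments $ j)" for m
    by (rule summable_rabs_cancel[OF summable_binomial_mult[OF z]])
  have ff: "falling_factorial (real j) m * (lam (int j - 1) - lam (int j)) =
      fact m * (real (j choose m) * increments $ j)" for j m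
    by (simp add: falling_factorial_eq_binomial increments_def)
  have coeff: "1 / fact m * (\<Sum>j. falling_factorial (real j) m * (lam (int j - 1) - lam (int j))) =
      fps_expand_at_1 increments $ m" for m
    unfolding ff using summable_choose[of m] by (simp add: suminf_mult fps_expand_at_1_def)
  define S where "S = (\<Sum>k=1..r. t powr (real k * \<alpha>) / Gamma (real k * \<alpha> + 1) *
      (fps_expand_at_1 increments ^ k) $ r)"
  have "(\<lambda>n. real (n choose r) * state_prob M N (int n) t) sums S"
  \<comment> \<open>The governing equation holds for positive times only. At \<open>t = 0\<close>
    the initial law makes the moment vanish, and so does \<open>0 powr x = 0\<close> the right-hand
    side.\<close>
  proof (cases "t = 0")
    case True
    have "(\<lambda>n. real (n choose r) * state_prob M N (int n) 0) = (\<lambda>_. 0)"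
    proof
      fix n
      show "real (n choose r) * state_prob M N (int n) 0 = 0"
        using initial_pos[of "int n"] \<open>r \<ge> 1\<close> by (cases "n = 0") auto
    qed
    then show ?thesis
      by (simp add: True S_def)
  next
    case False
    then show ?thesis
      using binomial_moment_sums[of t r] assms by (simp add: S_def)
  qed
  then have sums: "(\<lambda>n. falling_factorial (real n) r * prob {\<omega> \<in> space M. N t \<omega> = n}) sums (fact r * S)"
    using sums_mult[of _ S "fact r"]
    by (simp add: falling_factorial_eq_binomial state_prob_def mult.assoc)
  \<comment> \<open>Falling factorials of natural numbers are nonnegative, so the absolute values
    disappear.\<close>
  have "summable (\<lambda>n. \<bar>falling_factorial (real n) r\<bar> * prob {\<omega> \<in> space M. N t \<omega> = n})"
    using sums by (simp add: falling_factorial_eq_binomial sums_iff)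
  note moment = integral_nat_valued[OF random_var[OF \<open>t \<ge> 0\<close>] this]
  have power_coeff: "(\<Sum>m\<in>{m \<in> {1..k} \<rightarrow>\<^sub>E (UNIV :: nat set). (\<Sum>l=1..k. m l) = r}.
      \<Prod>l=1..k. 1 / fact (m l) *
        (\<Sum>j. falling_factorial (real j) (m l) * (lam (int j - 1) - lam (int j)))) =
      (fps_expand_at_1 increments ^ k) $ r" if "k \<in> {1..r}" for k
    unfolding coeff using that by (intro fps_power_nth_PiE [symmetric]) auto
  have "factorial_moment M (N t) r = fact r * S"
    using moment(2) sums by (simp add: factorial_moment_def sums_iff)
  also have "S = (\<Sum>k=1..r. t powr (real k * \<alpha>) / Gamma (real k * \<alpha> + 1) *
        (\<Sum>m \<in> {m \<in> {1..k} \<rightarrow>\<^sub>E (UNIV :: nat set). (\<Sum>l=1..k. m l) = r}.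
          (\<Prod>l=1..k. 1 / fact (m l) *
            (\<Sum>j::nat. falling_factorial (real j) (m l) * (lam (int j - 1) - lam (int j))))))"
    unfolding S_def by (intro sum.cong refl) (simp only: power_coeff)
  finally have "factorial_moment M (N t) r =
      fact r * (\<Sum>k=1..r. t powr (real k * \<alpha>) / Gamma (real k * \<alpha> + 1) *
        (\<Sum>m \<in> {m \<in> {1..k} \<rightarrow>\<^sub>E (UNIV :: nat set). (\<Sum>l=1..k. m l) = r}.
          (\<Prod>l=1..k. 1 / fact (m l) *
            (\<Sum>j::nat. falling_factorial (real j) (m l) * (lam (int j - 1) - lam (int j))))))" .
  moreover have "summable (\<lambda>j. falling_factorial (real j) m * (lam (int j - 1) - lam (int j)))" for m
    unfolding ff using summable_choose by (intro summable_mult)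
  ultimately show ?thesis
    using moment(1) by blast
qed

end
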